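(* Let $\{a_n\}_{n\ge 0}$ be a sequence of real numbers, let \[ t(x,y)=4(1-x)(1-y)-(1-xy)^2 \quad\text{and}\quad u_n=\frac{a_{n-1}a_{n+1}}{a_n^2}. \] Suppose there exist an integer $N\ge 1$ (with $a_n\ne 0$ for all $n\ge N$) and real sequences $f_n$, $g_n$ such that for all $n\ge N$, \[ g_n<u_n<f_n \] and \[ t(g_n,g_{n+1})>0,\quad t(g_n,f_{n+1})>0,\quad t(f_n,g_{n+1})>0,\quad t(f_n,f_{n+1})>0. \] Then $\{a_n\}_{n\ge N}$ satisfies the higher order Turán inequality.
   Context: The sequence $\{a_n\}_{n\ge N}$ is said to satisfy the higher order Turán inequality if for all $n\ge N+1$, \[ 4(a_n^2-a_{n-1}a_{n+1})(a_{n+1}^2-a_na_{n+2})-(a_na_{n+1}-a_{n-1}a_{n+2})^2\ge 0. \] *)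

theory Defs
  imports Complex_Main
begin

(* The higher order Turan inequality for the sequence (a_n) with n >= N.
   Since n >= N + 1, the natural-number subtraction n - 1 is a true predecessor
   and only terms with index at least N occur. *)
definition higher_order_turan_from :: "(nat \<Rightarrow> real) \<Rightarrow> nat \<Rightarrow> bool" where
  "higher_order_turan_from a N \<longleftrightarrow>
    (\<forall>n\<ge>N + 1.
      4 * ((a n)\<^sup>2 - a (n - 1) * a (n + 1)) * ((a (n + 1))\<^sup>2 - a n * a (n + 2))
        - (a n * a (n + 1) - a (n - 1) * a (n + 2))\<^sup>2 \<ge> 0)"

definition turan_t :: "real \<Rightarrow> real \<Rightarrow> real" where
  "turan_t x y = 4 * (1 - x) * (1 - y) - (1 - x * y)\<^sup>2"

(* Meaningful for n >= 1 with a n nonzero; at n = 0 the truncated n - 1 is 0. *)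
definition turan_u :: "(nat \<Rightarrow> real) \<Rightarrow> nat \<Rightarrow> real" where
  "turan_u a n = a (n - 1) * a (n + 1) / (a n)\<^sup>2"

end

theory Submission imports Defs begin

text \<open>The polynomial \<open>t\<close> is symmetric and, for fixed \<open>x\<close>, is quadratic in \<open>y\<close> with leading
  coefficient \<open>- x\<^sup>2 \<le> 0\<close>, hence concave in each variable separately. Positivity at the four
  corners of a rectangle therefore spreads to its edges and then to its interior, so
  \<open>t (u\<^sub>n, u\<^sub>n\<^sub>+\<^sub>1) > 0\<close>. Multiplied by \<open>a\<^sub>n\<^sup>2 a\<^sub>n\<^sub>+\<^sub>1\<^sup>2\<close>, this is the higher order Turan expression.\<close>

lemma turan_t_commute: "turan_t x y = turan_t y x"
  unfolding turan_t_def by algebra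

lemma turan_t_pos_between:
  assumes "p < y" "y < q" "turan_t x p > 0" "turan_t x q > 0"
  shows "turan_t x y > 0"
proof -
  \<comment> \<open>The first two summands are linear interpolation in \<open>y\<close> between
    \<open>p\<close> and \<open>q\<close>, with denominators cleared. The last is the exact
    remainder of a quadratic with leading coefficient \<open>- x\<^sup>2\<close>; it may vanish, as
    when \<open>x = 0\<close>.\<close>
  have "(q - p) * turan_t x y
      = (q - y) * turan_t x p + (y - p) * turan_t x q + x\<^sup>2 * ((y - p) * (q - y) * (q - p))"
    unfolding turan_t_def by algebra
  also have "\<dots> > 0"
    using assms by (intro add_pos_nonneg add_pos_pos mult_pos_pos mult_nonneg_nonneg) auto
  finally show ?thesis
    using assms by (simp add: zero_less_mult_iff)
qed

lemma turan_t_pos_rectangle: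
  assumes "p < x" "x < q" "r < y" "y < s"
    and "turan_t p r > 0" "turan_t p s > 0" "turan_t q r > 0" "turan_t q s > 0"
  shows "turan_t x y > 0"
proof -
  have "turan_t p y > 0" "turan_t q y > 0"
    using turan_t_pos_between[OF assms(3,4,5,6)] turan_t_pos_between[OF assms(3,4,7,8)] .
  \<comment> \<open>Only the second argument can be interpolated, so symmetry exchanges the
    two.\<close>
  then have "turan_t y p > 0" "turan_t y q > 0"
    by (simp_all only: turan_t_commute[of y p] turan_t_commute[of y q])
  then have "turan_t y x > 0"
    by (rule turan_t_pos_between[OF assms(1,2)])
  then show ?thesis
    by (simp only: turan_t_commute[of x y])
qed

text \<open>The product of the two ratios cancels to \<open>a * d / (b * c)\<close>, so
  \<open>b\<^sup>2 * c\<^sup>2\<close> factors out of the product and of the square alike.\<close>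

lemma turan_expression_eq:
  fixes a b c d :: real
  assumes "b \<noteq> 0" "c \<noteq> 0"
  shows "4 * (b\<^sup>2 - a * c) * (c\<^sup>2 - b * d) - (b * c - a * d)\<^sup>2
    = b\<^sup>2 * c\<^sup>2 * turan_t (a * c / b\<^sup>2) (b * d / c\<^sup>2)"
proof -
  define x y where "x = a * c / b\<^sup>2" and "y = b * d / c\<^sup>2"
  have 1: "b\<^sup>2 - a * c = b\<^sup>2 * (1 - x)" and 2: "c\<^sup>2 - b * d = c\<^sup>2 * (1 - y)"
    using assms by (simp_all add: x_def y_def right_diff_distrib)
  have 3: "b * c - a * d = b * c * (1 - x * y)"
    using assms by (simp add: x_def y_def field_simps power2_eq_square)
  show ?thesis
    unfolding x_def[symmetric] y_def[symmetric] 1 2 3 turan_t_def by algebra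
qed

theorem theorem5p2:
  fixes a f g :: "nat \<Rightarrow> real" and N :: nat
  assumes "N \<ge> 1"
    and "\<And>n. n \<ge> N \<Longrightarrow> a n \<noteq> 0"
    and "\<And>n. n \<ge> N \<Longrightarrow> g n < turan_u a n \<and> turan_u a n < f n"
    and "\<And>n. n \<ge> N \<Longrightarrow> turan_t (g n) (g (n + 1)) > 0"
    and "\<And>n. n \<ge> N \<Longrightarrow> turan_t (g n) (f (n + 1)) > 0"
    and "\<And>n. n \<ge> N \<Longrightarrow> turan_t (f n) (g (n + 1)) > 0"
    and "\<And>n. n \<ge> N \<Longrightarrow> turan_t (f n) (f (n + 1)) > 0"
  shows "higher_order_turan_from a N"
  unfolding higher_order_turan_from_def
proof (intro allI impI)
  fix n assume "n \<ge> N + 1"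
  then have n: "n \<ge> N" "n + 1 \<ge> N" by simp_all
  have "turan_t (turan_u a n) (turan_u a (n + 1)) > 0"
    using assms(3)[OF n(1)] assms(3)[OF n(2)] assms(4-7)[OF n(1)]
    by (blast intro: turan_t_pos_rectangle[of "g n" _ "f n" "g (n + 1)" _ "f (n + 1)"])
  then have "(a n)\<^sup>2 * (a (n + 1))\<^sup>2 * turan_t (turan_u a n) (turan_u a (n + 1)) \<ge> 0"
    by simp
  \<comment> \<open>\<open>turan_u a (n + 1)\<close> involves \<open>a n\<close> and
    \<open>a (n + 2)\<close>, so both ratios come from the four consecutive terms starting at
    \<open>a (n - 1)\<close>.\<close>
  then show "4 * ((a n)\<^sup>2 - a (n - 1) * a (n + 1)) * ((a (n + 1))\<^sup>2 - a n * a (n + 2))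
        - (a n * a (n + 1) - a (n - 1) * a (n + 2))\<^sup>2 \<ge> 0"
    using turan_expression_eq[OF assms(2)[OF n(1)] assms(2)[OF n(2)], of "a (n - 1)" "a (n + 2)"]
    by (simp add: turan_u_def)
qed

end
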